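(* Let $A_1,A_2>0$ and $p,q,H_\circ,K_\circ$ be the smooth functions attached to a surface in $\mathbb{R}^3$ in curvature line coordinates $(\alpha,\beta)$ (see context), and let $L,M$ be its Gauss-Weingarten matrices. Let $\varepsilon_1,\varepsilon_2,\omega,k_1,k_2,\tau$ be smooth functions of $(\alpha,\beta)$ (the strains), put $$P=\frac{1}{A_2}\bigl((A_1\varepsilon_1)_\beta-(A_2\omega)_\alpha-\varepsilon_2(A_1)_\beta\bigr),\quad Q=\frac{1}{A_1}\bigl((A_2\varepsilon_2)_\alpha-(A_1\omega)_\beta-\varepsilon_1(A_2)_\alpha\bigr),$$ $$H_\circ'=-k_1A_1,\qquad K_\circ'=-k_2A_2,$$ and $$L'=\begin{pmatrix} p\omega & P+\omega_\alpha & H_\circ' \\ -P & -p\omega & \tau A_1-H_\circ\omega \\ -H_\circ' & -\tau A_1 & 0 \end{pmatrix},\quad M'=\begin{pmatrix} -q\omega & -Q & \tau A_2-K_\circ\omega \\ Q+\omega_\beta & q\omega & K_\circ' \\ -\tau A_2 & -K_\circ' & 0 \end{pmatrix}.$$ Then the relation $$L'_\beta-M'_\alpha=[L',M]+[L,M']$$ is equivalent to the system of equations $$P_\beta+Q_\alpha+\omega_{\alpha\beta}+H_\circ'K_\circ+H_\circ K_\circ'=0,$$ $$(H_\circ')_\beta-(PK_\circ+pK_\circ')=(\tau A_2)_\alpha+\tau(A_2)_\alpha-\omega(K_\circ)_\alpha,$$ $$(K_\circ')_\alpha-(QH_\circ+qH_\circ')=(\tau A_1)_\beta+\tau(A_1)_\beta-\omega(H_\circ)_\beta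 .$$
   Context: Subscripts $\alpha,\beta$ denote partial derivatives and $[X,Y]=XY-YX$. All functions are smooth on an open set of the $(\alpha,\beta)$-plane. Surface data: $\mathbf{r}(\alpha,\beta)$ is a surface in $\mathbb{R}^3$ in curvature line coordinates (first and second fundamental forms diagonal), with first fundamental form $A_1^2\,d\alpha^2+A_2^2\,d\beta^2$, unit tangents $\mathbf{e}_1=\mathbf{r}_\alpha/A_1$, $\mathbf{e}_2=\mathbf{r}_\beta/A_2$, and unit normal $\mathbf{N}$. The functions $p,q,H_\circ,K_\circ$ are defined by $$(A_1)_\beta=pA_2,\quad (A_2)_\alpha=qA_1,\quad \mathbf{N}_\alpha=H_\circ\mathbf{e}_1,\quad \mathbf{N}_\beta=K_\circ\mathbf{e}_2 .$$ The orthonormal frame $\Phi=(\mathbf{e}_1,\mathbf{e}_2,\mathbf{N})$ satisfies $\Phi_\alpha=\Phi L$, $\Phi_\beta=\Phi M$ with $$L=\begin{pmatrix} 0 & p & H_\circ \\ -p & 0 & 0 \\ -H_\circ & 0 & 0 \end{pmatrix},\quad M=\begin{pmatrix} 0 & -q & 0 \\ q & 0 & K_\circ \\ 0 & -K_\circ & 0 \end{pmatrix},$$ and the Gauss-Mainardi-Codazzi equations $L_\beta-M_\alpha=[L,M]$ hold, i.e. $$p_\beta+q_\alpha+H_\circ K_\circ=0,\quad (H_\circ)_\beta=pK_\circ,\quad (K_\circ)_\alpha=qH_\circ .$$ *)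

theory Defs
  imports "HOL-Analysis.Analysis"
begin

text \<open>Points of the parameter plane are pairs \<open>(\<alpha>, \<beta>)\<close>. The partial derivatives are defined for
  functions with values in any real normed space, so they apply to scalars, to vectors of
  \<open>real^3\<close> and, entrywise, to matrices of type \<open>real^3^3\<close>.\<close>

definition pd_alpha :: "(real \<times> real \<Rightarrow> 'a::real_normed_vector) \<Rightarrow> real \<times> real \<Rightarrow> 'a"
    (\<open>\<partial>\<^sub>\<alpha>\<close>)
  where "\<partial>\<^sub>\<alpha> f z = vector_derivative (\<lambda>s. f (s, snd z)) (at (fst z))"

definition pd_beta :: "(real \<times> real \<Rightarrow> 'a::real_normed_vector) \<Rightarrow> real \<times> real \<Rightarrow> 'a"
    (\<open>\<partial>\<^sub>\<beta>\<close>)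
  where "\<partial>\<^sub>\<beta> f z = vector_derivative (\<lambda>t. f (fst z, t)) (at (snd z))"

text \<open>Smooth means \<open>C\<^sup>\<infinity>\<close>. These predicates are meant for open sets \<open>U\<close> only; differentiability is
  Frechet differentiability.\<close>

primrec Ck_on :: "nat \<Rightarrow> (real \<times> real) set \<Rightarrow> (real \<times> real \<Rightarrow> 'a::real_normed_vector) \<Rightarrow> bool"
  where
    "Ck_on 0 U f \<longleftrightarrow> continuous_on U f"
  | "Ck_on (Suc n) U f \<longleftrightarrow>
       (\<forall>z\<in>U. f differentiable (at z)) \<and> Ck_on n U (\<partial>\<^sub>\<alpha> f) \<and> Ck_on n U (\<partial>\<^sub>\<beta> f)"

definition smooth_on :: "(real \<times> real) set \<Rightarrow> (real \<times> real \<Rightarrow> 'a::real_normed_vector) \<Rightarrow> bool"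
  where "smooth_on U f \<longleftrightarrow> (\<forall>n. Ck_on n U f)"

text \<open>A regular parametrised surface \<open>r\<close> with a chosen smooth unit normal field \<open>N\<close> (either
  orientation) whose first and second fundamental forms are both diagonal. The two off-diagonal
  coefficients are \<open>r\<^sub>\<alpha> \<bullet> r\<^sub>\<beta>\<close> and \<open>r\<^sub>\<alpha>\<^sub>\<beta> \<bullet> N\<close>. Given the first condition, regularity amounts to both
  tangent vectors being nonzero.\<close>

definition curvature_line_coordinates ::
    "(real \<times> real) set \<Rightarrow> (real \<times> real \<Rightarrow> real^3) \<Rightarrow> (real \<times> real \<Rightarrow> real^3) \<Rightarrow> bool"
  where "curvature_line_coordinates U r N \<longleftrightarrow>
    open U \<and> smooth_on U r \<and> smooth_on U N \<and>
    (\<forall>z\<in>U. \<partial>\<^sub>\<alpha> r z \<noteq> 0 \<and> \<partial>\<^sub>\<beta> r z \<noteq> 0 \<and>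
           norm (N z) = 1 \<and> N z \<bullet> \<partial>\<^sub>\<alpha> r z = 0 \<and> N z \<bullet> \<partial>\<^sub>\<beta> r z = 0 \<and>
           \<partial>\<^sub>\<alpha> r z \<bullet> \<partial>\<^sub>\<beta> r z = 0 \<and>
           \<partial>\<^sub>\<beta> (\<partial>\<^sub>\<alpha> r) z \<bullet> N z = 0)"

text \<open>The functions attached to such a surface. The unit tangents are \<open>e\<^sub>1 = r\<^sub>\<alpha> / A1\<close> and
  \<open>e\<^sub>2 = r\<^sub>\<beta> / A2\<close>. Only the defining relations are imposed: the Gauss-Weingarten and the
  Gauss-Mainardi-Codazzi equations are consequences and are not assumed.\<close>

definition surface_data ::
    "(real \<times> real) set \<Rightarrow> (real \<times> real \<Rightarrow> real^3) \<Rightarrow> (real \<times> real \<Rightarrow> real^3) \<Rightarrow>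
     (real \<times> real \<Rightarrow> real) \<Rightarrow> (real \<times> real \<Rightarrow> real) \<Rightarrow> (real \<times> real \<Rightarrow> real) \<Rightarrow>
     (real \<times> real \<Rightarrow> real) \<Rightarrow> (real \<times> real \<Rightarrow> real) \<Rightarrow> (real \<times> real \<Rightarrow> real) \<Rightarrow> bool"
  where "surface_data U r N A1 A2 p q H K \<longleftrightarrow>
    curvature_line_coordinates U r N \<and>
    smooth_on U A1 \<and> smooth_on U A2 \<and> smooth_on U p \<and> smooth_on U q \<and>
    smooth_on U H \<and> smooth_on U K \<and>
    (\<forall>z\<in>U. A1 z > 0 \<and> A2 z > 0 \<and>
           \<partial>\<^sub>\<alpha> r z \<bullet> \<partial>\<^sub>\<alpha> r z = (A1 z)\<^sup>2 \<and> \<partial>\<^sub>\<beta> r z \<bullet> \<partial>\<^sub>\<beta> r z = (A2 z)\<^sup>2 \<and>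
           \<partial>\<^sub>\<beta> A1 z = p z * A2 z \<and> \<partial>\<^sub>\<alpha> A2 z = q z * A1 z \<and>
           \<partial>\<^sub>\<alpha> N z = H z *\<^sub>R (\<partial>\<^sub>\<alpha> r z /\<^sub>R A1 z) \<and>
           \<partial>\<^sub>\<beta> N z = K z *\<^sub>R (\<partial>\<^sub>\<beta> r z /\<^sub>R A2 z))"

definition commutator :: "real^'n^'n \<Rightarrow> real^'n^'n \<Rightarrow> real^'n^'n"
  where "commutator X Y = X ** Y - Y ** X"

end

theory Submission
  imports Defs
begin

text \<open>Entrywise, the matrix relation consists of nine scalar equations. The \<open>(1,2)\<close>, \<open>(1,3)\<close>
  and \<open>(2,3)\<close> entries are exactly the three equations of the system. The \<open>(1,1)\<close> and \<open>(2,2)\<close> entries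
  are \<open>\<plusminus>\<omega>\<close> times the Gauss equation and the \<open>(3,3)\<close> entry is an identity. The
  \<open>(2,1)\<close> entry repeats \<open>(1,2)\<close> because the mixed partial derivatives of \<open>\<omega>\<close> agree, and \<open>(3,1)\<close>,
  \<open>(3,2)\<close> repeat \<open>(1,3)\<close>, \<open>(2,3)\<close> by the Mainardi-Codazzi equations. The Gauss-Mainardi-Codazzi
  equations themselves express the symmetry of the mixed partial derivatives of \<open>r\<close>, \<open>N\<close> and
  \<open>e\<^sub>1\<close> in the frame \<open>(e\<^sub>1, e\<^sub>2, N)\<close>.\<close>

subsection \<open>Partial derivatives and smooth functions\<close>

text \<open>The chain rule along the two coordinate lines through \<open>z\<close> identifies the
  partial derivatives with the total derivative at the basis vectors. Each rule for sums, products
  or inverses below is thus a \<open>has_derivative\<close> rule evaluated at \<open>(1, 0)\<close>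
  and \<open>(0, 1)\<close>.\<close>

lemma pd_has_derivative:
  assumes "(f has_derivative D) (at z)"
  shows "\<partial>\<^sub>\<alpha> f z = D (1, 0)" and "\<partial>\<^sub>\<beta> f z = D (0, 1)"
    and "((\<lambda>s. f (s, snd z)) has_vector_derivative D (1, 0)) (at (fst z))"
    and "((\<lambda>t. f (fst z, t)) has_vector_derivative D (0, 1)) (at (snd z))"
proof -
  interpret bounded_linear D
    using assms by (rule has_derivative_bounded_linear)
  have a: "((\<lambda>s. (s, snd z)) has_derivative (\<lambda>s. (s, 0))) (at (fst z))"
    and b: "((\<lambda>t. (fst z, t)) has_derivative (\<lambda>t. (0, t))) (at (snd z))"
    by (auto intro!: derivative_eq_intros)
  have D1: "D (s, 0) = s *\<^sub>R D (1, 0)" for s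
    using scaleR[of s "(1, 0)"] by simp
  have D2: "D (0, t) = t *\<^sub>R D (0, 1)" for t
    using scaleR[of t "(0, 1)"] by simp
  have A: "((\<lambda>s. f (s, snd z)) has_vector_derivative D (1, 0)) (at (fst z))"
    using has_derivative_compose[OF a, of f D] assms
    by (simp add: has_vector_derivative_def D1[symmetric])
  have B: "((\<lambda>t. f (fst z, t)) has_vector_derivative D (0, 1)) (at (snd z))"
    using has_derivative_compose[OF b, of f D] assms
    by (simp add: has_vector_derivative_def D2[symmetric])
  show "((\<lambda>s. f (s, snd z)) has_vector_derivative D (1, 0)) (at (fst z))"
    "((\<lambda>t. f (fst z, t)) has_vector_derivative D (0, 1)) (at (snd z))"
    by (fact A, fact B)
  show "\<partial>\<^sub>\<alpha> f z = D (1, 0)" "\<partial>\<^sub>\<beta> f z = D (0, 1)"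
    unfolding pd_alpha_def pd_beta_def using A B by (auto intro: vector_derivative_at)
qed

lemma pd_has_vector_derivative:
  assumes "f differentiable (at z)"
  shows "((\<lambda>s. f (s, snd z)) has_vector_derivative \<partial>\<^sub>\<alpha> f z) (at (fst z))"
    and "((\<lambda>t. f (fst z, t)) has_vector_derivative \<partial>\<^sub>\<beta> f z) (at (snd z))"
proof -
  obtain D where D: "(f has_derivative D) (at z)"
    using assms unfolding differentiable_def by blast
  show "((\<lambda>s. f (s, snd z)) has_vector_derivative \<partial>\<^sub>\<alpha> f z) (at (fst z))"
    "((\<lambda>t. f (fst z, t)) has_vector_derivative \<partial>\<^sub>\<beta> f z) (at (snd z))"
    using pd_has_derivative(3,4)[OF D] by (simp_all only: pd_has_derivative(1,2)[OF D])
qed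

lemma pd_add:
  assumes "f differentiable (at z)" "g differentiable (at z)"
  shows "\<partial>\<^sub>\<alpha> (\<lambda>z. f z + g z) z = \<partial>\<^sub>\<alpha> f z + \<partial>\<^sub>\<alpha> g z"
    and "\<partial>\<^sub>\<beta> (\<lambda>z. f z + g z) z = \<partial>\<^sub>\<beta> f z + \<partial>\<^sub>\<beta> g z"
proof -
  obtain F G where F: "(f has_derivative F) (at z)" and G: "(g has_derivative G) (at z)"
    using assms unfolding differentiable_def by blast
  note FG = has_derivative_add[OF F G]
  show "\<partial>\<^sub>\<alpha> (\<lambda>z. f z + g z) z = \<partial>\<^sub>\<alpha> f z + \<partial>\<^sub>\<alpha> g z"
    "\<partial>\<^sub>\<beta> (\<lambda>z. f z + g z) z = \<partial>\<^sub>\<beta> f z + \<partial>\<^sub>\<beta> g z"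
    by (simp_all only: pd_has_derivative(1,2)[OF F] pd_has_derivative(1,2)[OF G]
        pd_has_derivative(1,2)[OF FG])
qed

text \<open>One rule serves negation, the inner product with a fixed vector and the projection to a
  coordinate.\<close>

lemma pd_bounded_linear:
  assumes "bounded_linear h" "f differentiable (at z)"
  shows "\<partial>\<^sub>\<alpha> (\<lambda>z. h (f z)) z = h (\<partial>\<^sub>\<alpha> f z)" and "\<partial>\<^sub>\<beta> (\<lambda>z. h (f z)) z = h (\<partial>\<^sub>\<beta> f z)"
proof -
  obtain F where F: "(f has_derivative F) (at z)"
    using assms unfolding differentiable_def by blast
  note hF = bounded_linear.has_derivative[OF assms(1) F]
  show "\<partial>\<^sub>\<alpha> (\<lambda>z. h (f z)) z = h (\<partial>\<^sub>\<alpha> f z)" "\<partial>\<^sub>\<beta> (\<lambda>z. h (f z)) z = h (\<partial>\<^sub>\<beta> f z)"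
    by (simp_all only: pd_has_derivative(1,2)[OF F] pd_has_derivative(1,2)[OF hF])
qed

lemmas pd_minus = pd_bounded_linear[OF bounded_linear_minus[OF bounded_linear_ident]]

lemma pd_diff:
  assumes "f differentiable (at z)" "g differentiable (at z)"
  shows "\<partial>\<^sub>\<alpha> (\<lambda>z. f z - g z) z = \<partial>\<^sub>\<alpha> f z - \<partial>\<^sub>\<alpha> g z"
    and "\<partial>\<^sub>\<beta> (\<lambda>z. f z - g z) z = \<partial>\<^sub>\<beta> f z - \<partial>\<^sub>\<beta> g z"
  using pd_add[OF assms(1) differentiable_minus[OF assms(2)]] pd_minus[OF assms(2)] by simp_all

text \<open>The Leibniz rule in this generality covers products, scalar multiples of vectors and
  inner products at once.\<close>

lemma pd_bounded_bilinear:
  assumes "bounded_bilinear h" "f differentiable (at z)" "g differentiable (at z)"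
  shows "\<partial>\<^sub>\<alpha> (\<lambda>z. h (f z) (g z)) z = h (f z) (\<partial>\<^sub>\<alpha> g z) + h (\<partial>\<^sub>\<alpha> f z) (g z)"
    and "\<partial>\<^sub>\<beta> (\<lambda>z. h (f z) (g z)) z = h (f z) (\<partial>\<^sub>\<beta> g z) + h (\<partial>\<^sub>\<beta> f z) (g z)"
    and "(\<lambda>z. h (f z) (g z)) differentiable (at z)"
proof -
  obtain F G where F: "(f has_derivative F) (at z)" and G: "(g has_derivative G) (at z)"
    using assms unfolding differentiable_def by blast
  note FG = bounded_bilinear.FDERIV[OF assms(1) F G]
  show "\<partial>\<^sub>\<alpha> (\<lambda>z. h (f z) (g z)) z = h (f z) (\<partial>\<^sub>\<alpha> g z) + h (\<partial>\<^sub>\<alpha> f z) (g z)"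
    "\<partial>\<^sub>\<beta> (\<lambda>z. h (f z) (g z)) z = h (f z) (\<partial>\<^sub>\<beta> g z) + h (\<partial>\<^sub>\<beta> f z) (g z)"
    by (simp_all only: pd_has_derivative(1,2)[OF F] pd_has_derivative(1,2)[OF G]
        pd_has_derivative(1,2)[OF FG])
  show "(\<lambda>z. h (f z) (g z)) differentiable (at z)"
    using FG by (rule differentiableI)
qed

lemmas pd_mult = pd_bounded_bilinear(1,2)[OF bounded_bilinear_mult]
lemmas pd_scaleR = pd_bounded_bilinear(1,2)[OF bounded_bilinear_scaleR]
lemmas pd_inner = pd_bounded_bilinear(1,2)[OF bounded_bilinear_inner]

lemma pd_inverse:
  fixes f :: "real \<times> real \<Rightarrow> real"
  assumes "f differentiable (at z)" "f z \<noteq> 0"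
  shows "\<partial>\<^sub>\<alpha> (\<lambda>z. inverse (f z)) z = - (inverse (f z) * \<partial>\<^sub>\<alpha> f z * inverse (f z))"
    and "\<partial>\<^sub>\<beta> (\<lambda>z. inverse (f z)) z = - (inverse (f z) * \<partial>\<^sub>\<beta> f z * inverse (f z))"
proof -
  obtain F where F: "(f has_derivative F) (at z)"
    using assms unfolding differentiable_def by blast
  note iF = Deriv.has_derivative_inverse[OF assms(2) F]
  show "\<partial>\<^sub>\<alpha> (\<lambda>z. inverse (f z)) z = - (inverse (f z) * \<partial>\<^sub>\<alpha> f z * inverse (f z))"
    "\<partial>\<^sub>\<beta> (\<lambda>z. inverse (f z)) z = - (inverse (f z) * \<partial>\<^sub>\<beta> f z * inverse (f z))"
    by (simp_all only: pd_has_derivative(1,2)[OF F] pd_has_derivative(1,2)[OF iF])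
qed

lemma pd_const: "\<partial>\<^sub>\<alpha> (\<lambda>z. c) z = 0" "\<partial>\<^sub>\<beta> (\<lambda>z. c) z = 0"
  using pd_has_derivative(1,2)[OF has_derivative_const[of c "at z"]] by simp_all

text \<open>Functions are total on the plane, but the identities between them hold only on
  \<open>U\<close>. Since a derivative depends only on the germ at \<open>z\<close>, such an
  identity may still be differentiated.\<close>

lemma pd_cong_open:
  assumes "open U" "z \<in> U" "\<And>w. w \<in> U \<Longrightarrow> f w = g w"
  shows "\<partial>\<^sub>\<alpha> f z = \<partial>\<^sub>\<alpha> g z" and "\<partial>\<^sub>\<beta> f z = \<partial>\<^sub>\<beta> g z"
proof -
  have ev: "eventually (\<lambda>w. f w = g w) (nhds z)"
    using assms eventually_nhds by blast
  \<comment> \<open>Continuity of the embedded coordinate line carries the agreement near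
    \<open>z\<close> over to agreement near \<open>fst z\<close>.\<close>
  have "((\<lambda>s. (s, snd z)) \<longlongrightarrow> (fst z, snd z)) (nhds (fst z))"
    by (intro tendsto_Pair tendsto_const filterlim_ident)
  hence "eventually (\<lambda>s. f (s, snd z) = g (s, snd z)) (nhds (fst z))"
    using ev unfolding prod.collapse filterlim_iff by blast
  thus "\<partial>\<^sub>\<alpha> f z = \<partial>\<^sub>\<alpha> g z"
    unfolding pd_alpha_def by (intro vector_derivative_cong_eq) auto
  have "((\<lambda>t. (fst z, t)) \<longlongrightarrow> (fst z, snd z)) (nhds (snd z))"
    by (intro tendsto_Pair tendsto_const filterlim_ident)
  hence "eventually (\<lambda>t. f (fst z, t) = g (fst z, t)) (nhds (snd z))"
    using ev unfolding prod.collapse filterlim_iff by blast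
  thus "\<partial>\<^sub>\<beta> f z = \<partial>\<^sub>\<beta> g z"
    unfolding pd_beta_def by (intro vector_derivative_cong_eq) auto
qed

text \<open>Differentiation rules give a formula for a derivative at points of \<open>U\<close>
  only. This lemma lets the formula replace the derivative in the inductions on the order
  \<open>n\<close>.\<close>

lemma Ck_on_cong:
  assumes "open U" "\<And>w. w \<in> U \<Longrightarrow> f w = g w" "Ck_on n U f"
  shows "Ck_on n U g"
  using assms(2,3)
proof (induction n arbitrary: f g)
  case 0
  thus ?case by (auto intro: continuous_on_eq)
next
  case (Suc n)
  have "g differentiable (at z)" if "z \<in> U" for z
  proof -
    have "f differentiable (at z)" using Suc.prems(2) that by simp
    then obtain D where "(f has_derivative D) (at z)"
      unfolding differentiable_def by blast
    hence "(g has_derivative D) (at z)"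
      by (rule has_derivative_transform_within_open[OF _ assms(1) that]) (use Suc.prems in auto)
    thus ?thesis by (rule differentiableI)
  qed
  moreover have "Ck_on n U (\<partial>\<^sub>\<alpha> g)"
    by (rule Suc.IH[of "\<partial>\<^sub>\<alpha> f"]) (use Suc.prems pd_cong_open(1)[OF assms(1), of _ f g] in simp_all)
  moreover have "Ck_on n U (\<partial>\<^sub>\<beta> g)"
    by (rule Suc.IH[of "\<partial>\<^sub>\<beta> f"]) (use Suc.prems pd_cong_open(2)[OF assms(1), of _ f g] in simp_all)
  ultimately show ?case by simp
qed

text \<open>Leibniz formulas contain undifferentiated factors, for which the induction supplies
  order \<open>Suc n\<close> where order \<open>n\<close> is wanted. The base case is that
  differentiability implies continuity.\<close>

lemma Ck_on_Suc_D: "Ck_on (Suc n) U f \<Longrightarrow> Ck_on n U f"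
proof (induction n arbitrary: f)
  case 0
  thus ?case
    by (auto intro!: continuous_at_imp_continuous_on differentiable_imp_continuous_within)
next
  case (Suc n)
  have "\<forall>z\<in>U. f differentiable (at z)" "Ck_on (Suc n) U (\<partial>\<^sub>\<alpha> f)" "Ck_on (Suc n) U (\<partial>\<^sub>\<beta> f)"
    using Suc.prems unfolding Ck_on.simps(2)[of "Suc n"] by blast+
  thus ?case using Suc.IH unfolding Ck_on.simps(2)[of n] by blast
qed

section \<open>Closure of the classes \<open>Ck_on\<close> under algebraic operations\<close>

lemma Ck_on_add:
  assumes "open U" "Ck_on n U f" "Ck_on n U g"
  shows "Ck_on n U (\<lambda>z. f z + g z)"
  using assms(2,3)
proof (induction n arbitrary: f g)
  case 0
  thus ?case by (auto intro: continuous_on_add)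
next
  case (Suc n)
  have "Ck_on n U (\<partial>\<^sub>\<alpha> (\<lambda>z. f z + g z))"
    by (rule Ck_on_cong[OF assms(1), of "\<lambda>z. \<partial>\<^sub>\<alpha> f z + \<partial>\<^sub>\<alpha> g z"])
      (use Suc in \<open>auto simp: pd_add\<close>)
  moreover have "Ck_on n U (\<partial>\<^sub>\<beta> (\<lambda>z. f z + g z))"
    by (rule Ck_on_cong[OF assms(1), of "\<lambda>z. \<partial>\<^sub>\<beta> f z + \<partial>\<^sub>\<beta> g z"])
      (use Suc in \<open>auto simp: pd_add\<close>)
  ultimately show ?case using Suc.prems by auto
qed

text \<open>A derivative of \<open>h (f z) (g z)\<close> is a sum of two terms of the same shape
  with one factor differentiated, so the induction on \<open>n\<close> must leave both
  \<open>f\<close> and \<open>g\<close> arbitrary.\<close>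

lemma Ck_on_bounded_bilinear:
  assumes "bounded_bilinear h" "open U" "Ck_on n U f" "Ck_on n U g"
  shows "Ck_on n U (\<lambda>z. h (f z) (g z))"
  using assms(3,4)
proof (induction n arbitrary: f g)
  case 0
  thus ?case by (auto intro: bounded_bilinear.continuous_on[OF assms(1)])
next
  case (Suc n)
  note less = Suc.prems[THEN Ck_on_Suc_D]
  have "Ck_on n U (\<partial>\<^sub>\<alpha> (\<lambda>z. h (f z) (g z)))"
    by (rule Ck_on_cong[OF assms(2), of "\<lambda>z. h (f z) (\<partial>\<^sub>\<alpha> g z) + h (\<partial>\<^sub>\<alpha> f z) (g z)"])
      (use Suc less in \<open>auto simp: pd_bounded_bilinear[OF assms(1)] intro!: Ck_on_add[OF assms(2)]\<close>)
  moreover have "Ck_on n U (\<partial>\<^sub>\<beta> (\<lambda>z. h (f z) (g z)))"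
    by (rule Ck_on_cong[OF assms(2), of "\<lambda>z. h (f z) (\<partial>\<^sub>\<beta> g z) + h (\<partial>\<^sub>\<beta> f z) (g z)"])
      (use Suc less in \<open>auto simp: pd_bounded_bilinear[OF assms(1)] intro!: Ck_on_add[OF assms(2)]\<close>)
  ultimately show ?case
    using Suc.prems by (auto intro: pd_bounded_bilinear(3)[OF assms(1)])
qed

lemma Ck_on_const: "Ck_on n U (\<lambda>z. c)"
proof (induction n arbitrary: c)
  case (Suc n)
  thus ?case by (simp add: pd_const[abs_def])
qed auto

text \<open>The derivative of \<open>1/f\<close> is again built from \<open>1/f\<close> and a
  derivative of \<open>f\<close>. The induction hypothesis for the same \<open>f\<close>, at one
  order less, therefore suffices.\<close>

lemma Ck_on_inverse:
  fixes f :: "real \<times> real \<Rightarrow> real"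
  assumes "open U" "Ck_on n U f" "\<And>z. z \<in> U \<Longrightarrow> f z \<noteq> 0"
  shows "Ck_on n U (\<lambda>z. inverse (f z))"
  using assms(2)
proof (induction n)
  case 0
  thus ?case using assms(3) by (auto intro: continuous_on_inverse)
next
  case (Suc n)
  note mult = Ck_on_bounded_bilinear[OF bounded_bilinear_mult assms(1)]
  have inv: "Ck_on n U (\<lambda>z. inverse (f z))"
    using Suc.IH Suc.prems Ck_on_Suc_D by blast
  have "Ck_on n U (\<partial>\<^sub>\<alpha> (\<lambda>z. inverse (f z)))"
  proof (rule Ck_on_cong[OF assms(1)])
    \<comment> \<open>Writing the sign as a constant factor reduces everything to products.\<close>
    show "Ck_on n U (\<lambda>z. (-1) * (inverse (f z) * \<partial>\<^sub>\<alpha> f z * inverse (f z)))"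
      using Suc.prems by (intro mult Ck_on_const inv) auto
  qed (use Suc.prems assms(3) in \<open>simp add: pd_inverse\<close>)
  moreover have "Ck_on n U (\<partial>\<^sub>\<beta> (\<lambda>z. inverse (f z)))"
  proof (rule Ck_on_cong[OF assms(1)])
    show "Ck_on n U (\<lambda>z. (-1) * (inverse (f z) * \<partial>\<^sub>\<beta> f z * inverse (f z)))"
      using Suc.prems by (intro mult Ck_on_const inv) auto
  qed (use Suc.prems assms(3) in \<open>simp add: pd_inverse\<close>)
  ultimately show ?case
    using Suc.prems assms(3) by (auto intro: differentiable_inverse)
qed

section \<open>Closure of smooth functions under derivatives and algebraic operations\<close>

lemma smooth_onD:
  assumes "smooth_on U f"
  shows "z \<in> U \<Longrightarrow> f differentiable (at z)" "smooth_on U (\<partial>\<^sub>\<alpha> f)" "smooth_on U (\<partial>\<^sub>\<beta> f)"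
proof -
  have "Ck_on (Suc n) U f" for n
    using assms by (simp add: smooth_on_def)
  thus "z \<in> U \<Longrightarrow> f differentiable (at z)" "smooth_on U (\<partial>\<^sub>\<alpha> f)" "smooth_on U (\<partial>\<^sub>\<beta> f)"
    by (simp_all add: smooth_on_def)
qed

lemma smooth_on_const: "smooth_on U (\<lambda>z. c)"
  by (simp add: smooth_on_def Ck_on_const)

lemma smooth_on_add:
  assumes "open U" "smooth_on U f" "smooth_on U g"
  shows "smooth_on U (\<lambda>z. f z + g z)"
  using assms by (simp add: smooth_on_def Ck_on_add)

lemma smooth_on_bounded_bilinear:
  assumes "bounded_bilinear h" "open U" "smooth_on U f" "smooth_on U g"
  shows "smooth_on U (\<lambda>z. h (f z) (g z))"
  using assms(3,4) Ck_on_bounded_bilinear[OF assms(1,2)] unfolding smooth_on_def by blast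

lemmas smooth_on_mult = smooth_on_bounded_bilinear[OF bounded_bilinear_mult]
lemmas smooth_on_scaleR = smooth_on_bounded_bilinear[OF bounded_bilinear_scaleR]
lemmas smooth_on_inner = smooth_on_bounded_bilinear[OF bounded_bilinear_inner]

lemma smooth_on_minus:
  assumes "open U" "smooth_on U f"
  shows "smooth_on U (\<lambda>z. - f z)"
  using smooth_on_scaleR[OF assms(1) smooth_on_const assms(2), of "-1"] by simp

lemma smooth_on_diff:
  assumes "open U" "smooth_on U f" "smooth_on U g"
  shows "smooth_on U (\<lambda>z. f z - g z)"
  using smooth_on_add[OF assms(1,2) smooth_on_minus[OF assms(1,3)]] by (simp only: diff_conv_add_uminus)

lemma smooth_on_inverse:
  fixes f :: "real \<times> real \<Rightarrow> real"
  assumes "open U" "smooth_on U f" "\<And>z. z \<in> U \<Longrightarrow> f z \<noteq> 0"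
  shows "smooth_on U (\<lambda>z. inverse (f z))"
  using assms by (simp add: smooth_on_def Ck_on_inverse)

subsection \<open>Symmetry of the mixed partial derivatives\<close>

text \<open>Two applications of the mean value theorem, in either order, to the second difference of
  \<open>f\<close> over a small square.\<close>

lemma pd_mixed_difference:
  fixes f :: "real \<times> real \<Rightarrow> real"
  assumes h: "h > 0" and sq: "{a..a+h} \<times> {b..b+h} \<subseteq> U"
    and diff: "\<And>z. z \<in> U \<Longrightarrow> f differentiable (at z)"
      "\<And>z. z \<in> U \<Longrightarrow> \<partial>\<^sub>\<alpha> f differentiable (at z)" "\<And>z. z \<in> U \<Longrightarrow> \<partial>\<^sub>\<beta> f differentiable (at z)"
  shows "\<exists>w \<in> {a..a+h} \<times> {b..b+h}.
      f (a+h, b+h) - f (a+h, b) - f (a, b+h) + f (a, b) = h * h * \<partial>\<^sub>\<beta> (\<partial>\<^sub>\<alpha> f) w" (is ?A)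
    and "\<exists>w \<in> {a..a+h} \<times> {b..b+h}.
      f (a+h, b+h) - f (a+h, b) - f (a, b+h) + f (a, b) = h * h * \<partial>\<^sub>\<alpha> (\<partial>\<^sub>\<beta> f) w" (is ?B)
proof -
  have d1: "((\<lambda>s. g (s, t)) has_real_derivative \<partial>\<^sub>\<alpha> g (s, t)) (at s)"
    if "g differentiable (at (s, t))" for g :: "real \<times> real \<Rightarrow> real" and s t
    using pd_has_vector_derivative(1)[OF that]
    by (simp add: has_real_derivative_iff_has_vector_derivative)
  have d2: "((\<lambda>t. g (s, t)) has_real_derivative \<partial>\<^sub>\<beta> g (s, t)) (at t)"
    if "g differentiable (at (s, t))" for g :: "real \<times> real \<Rightarrow> real" and s t
    using pd_has_vector_derivative(2)[OF that]
    by (simp add: has_real_derivative_iff_has_vector_derivative)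
  have in_U: "(s, t) \<in> U" if "a \<le> s" "s \<le> a+h" "b \<le> t" "t \<le> b+h" for s t
    using that sq by auto
  show ?A
  proof -
    have "\<exists>x. a < x \<and> x < a+h \<and> (f (a+h, b+h) - f (a+h, b)) - (f (a, b+h) - f (a, b))
        = (a+h-a) * (\<partial>\<^sub>\<alpha> f (x, b+h) - \<partial>\<^sub>\<alpha> f (x, b))"
      using h by (intro MVT2[where f = "\<lambda>s. f (s, b+h) - f (s, b)"] DERIV_diff d1 diff in_U) auto
    then obtain x where x: "a < x" "x < a+h"
      "(f (a+h, b+h) - f (a+h, b)) - (f (a, b+h) - f (a, b))
        = h * (\<partial>\<^sub>\<alpha> f (x, b+h) - \<partial>\<^sub>\<alpha> f (x, b))"
      by auto
    have "\<exists>y. b < y \<and> y < b+h \<and> \<partial>\<^sub>\<alpha> f (x, b+h) - \<partial>\<^sub>\<alpha> f (x, b) = (b+h-b) * \<partial>\<^sub>\<beta> (\<partial>\<^sub>\<alpha> f) (x, y)"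
      using h x by (intro MVT2[where f = "\<lambda>t. \<partial>\<^sub>\<alpha> f (x, t)"] d2 diff in_U) auto
    then obtain y where "b < y" "y < b+h"
      "\<partial>\<^sub>\<alpha> f (x, b+h) - \<partial>\<^sub>\<alpha> f (x, b) = h * \<partial>\<^sub>\<beta> (\<partial>\<^sub>\<alpha> f) (x, y)"
      by auto
    with x show ?A by (intro bexI[of _ "(x, y)"]) auto
  qed
  show ?B
  proof -
    \<comment> \<open>The same second difference is now grouped by the horizontal edges of the
      square, so that \<beta> is the first variable for the mean value theorem.\<close>
    have "\<exists>y. b < y \<and> y < b+h \<and> (f (a+h, b+h) - f (a, b+h)) - (f (a+h, b) - f (a, b))
        = (b+h-b) * (\<partial>\<^sub>\<beta> f (a+h, y) - \<partial>\<^sub>\<beta> f (a, y))"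
      using h by (intro MVT2[where f = "\<lambda>t. f (a+h, t) - f (a, t)"] DERIV_diff d2 diff in_U) auto
    then obtain y where y: "b < y" "y < b+h"
      "(f (a+h, b+h) - f (a, b+h)) - (f (a+h, b) - f (a, b))
        = h * (\<partial>\<^sub>\<beta> f (a+h, y) - \<partial>\<^sub>\<beta> f (a, y))"
      by auto
    have "\<exists>x. a < x \<and> x < a+h \<and> \<partial>\<^sub>\<beta> f (a+h, y) - \<partial>\<^sub>\<beta> f (a, y) = (a+h-a) * \<partial>\<^sub>\<alpha> (\<partial>\<^sub>\<beta> f) (x, y)"
      using h y by (intro MVT2[where f = "\<lambda>s. \<partial>\<^sub>\<beta> f (s, y)"] d1 diff in_U) auto
    then obtain x where "a < x" "x < a+h"
      "\<partial>\<^sub>\<beta> f (a+h, y) - \<partial>\<^sub>\<beta> f (a, y) = h * \<partial>\<^sub>\<alpha> (\<partial>\<^sub>\<beta> f) (x, y)"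
      by auto
    with y show ?B by (intro bexI[of _ "(x, y)"]) auto
  qed
qed

text \<open>On every small square at \<open>z\<close> the two mixed derivatives attain a common
  value, possibly at different points. Both are continuous at \<open>z\<close>, so shrinking the
  square forces equality there.\<close>

lemma pd_commute_real:
  fixes f :: "real \<times> real \<Rightarrow> real"
  assumes "open U" "Ck_on 2 U f" "z \<in> U"
  shows "\<partial>\<^sub>\<beta> (\<partial>\<^sub>\<alpha> f) z = \<partial>\<^sub>\<alpha> (\<partial>\<^sub>\<beta> f) z"
proof -
  let ?F = "\<partial>\<^sub>\<beta> (\<partial>\<^sub>\<alpha> f)" and ?G = "\<partial>\<^sub>\<alpha> (\<partial>\<^sub>\<beta> f)"
  have C2: "\<And>z. z \<in> U \<Longrightarrow> f differentiable (at z)"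
      "\<And>z. z \<in> U \<Longrightarrow> \<partial>\<^sub>\<alpha> f differentiable (at z)" "\<And>z. z \<in> U \<Longrightarrow> \<partial>\<^sub>\<beta> f differentiable (at z)"
      "continuous_on U ?F" "continuous_on U ?G"
    using assms(2) by (auto simp: numeral_2_eq_2)
  obtain a b where z: "z = (a, b)" by fastforce
  have close: "dist (?F z) (?G z) \<le> e" if "e > 0" for e
  proof -
    have "eventually (\<lambda>w. w \<in> U \<and> dist (?F w) (?F z) < e/2 \<and> dist (?G w) (?G z) < e/2) (nhds z)"
      using C2(4,5) assms(1,3) \<open>e > 0\<close>
      by (intro eventually_conj eventually_nhds_in_open tendstoD)
        (auto simp: continuous_on_eq_continuous_at isCont_def tendsto_at_iff_tendsto_nhds)
    then obtain d where d: "d > 0"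
      "\<And>w. dist w z < d \<Longrightarrow> w \<in> U \<and> dist (?F w) (?F z) < e/2 \<and> dist (?G w) (?G z) < e/2"
      unfolding eventually_nhds_metric by auto
    \<comment> \<open>The distance from \<open>z\<close> to a point of the closed square is at most
      \<open>h + h\<close>, which is \<open>2*d/3\<close> and hence strictly below
      \<open>d\<close>.\<close>
    define h where "h = d/3"
    have h: "h > 0" using d by (simp add: h_def)
    have near: "dist w z < d" if "w \<in> {a..a+h} \<times> {b..b+h}" for w
    proof -
      have "dist w z \<le> \<bar>fst w - a\<bar> + \<bar>snd w - b\<bar>"
        using sqrt_sum_squares_le_sum_abs[of "fst w - a" "snd w - b"]
        by (cases w) (simp add: z dist_Pair_Pair dist_real_def)
      also have "\<dots> \<le> h + h" using that by (cases w) auto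
      also have "\<dots> < d" using d by (simp add: h_def)
      finally show ?thesis .
    qed
    have sq: "{a..a+h} \<times> {b..b+h} \<subseteq> U" using near d(2) by blast
    obtain v where v: "v \<in> {a..a+h} \<times> {b..b+h}"
      "f (a+h, b+h) - f (a+h, b) - f (a, b+h) + f (a, b) = h * h * ?F v"
      using pd_mixed_difference(1)[OF h sq C2(1-3)] by blast
    obtain w where w: "w \<in> {a..a+h} \<times> {b..b+h}"
      "f (a+h, b+h) - f (a+h, b) - f (a, b+h) + f (a, b) = h * h * ?G w"
      using pd_mixed_difference(2)[OF h sq C2(1-3)] by blast
    have "?F v = ?G w" using v(2) w(2) h by simp
    moreover have "dist (?F v) (?F z) < e/2" "dist (?G w) (?G z) < e/2"
      using d(2) near v(1) w(1) by auto
    ultimately show ?thesis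
      using dist_triangle_half_l[of "?F z" "?F v" e "?G z"] by (simp add: dist_commute)
  qed
  have "dist (?F z) (?G z) \<le> 0"
    by (rule field_le_epsilon) (simp only: add_0 close)
  thus ?thesis by simp
qed

text \<open>The claim reduces to the real case in each coordinate, because the inner product with a
  basis vector commutes with partial derivatives.\<close>

lemma pd_commute:
  fixes f :: "real \<times> real \<Rightarrow> 'a::euclidean_space"
  assumes "open U" "smooth_on U f" "z \<in> U"
  shows "\<partial>\<^sub>\<beta> (\<partial>\<^sub>\<alpha> f) z = \<partial>\<^sub>\<alpha> (\<partial>\<^sub>\<beta> f) z"
proof (rule euclidean_eqI)
  fix i :: 'a assume "i \<in> Basis"
  let ?g = "\<lambda>z. f z \<bullet> i"
  note lin = pd_bounded_linear[OF bounded_linear_inner_left[of i]]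
  note smooth = assms(2) smooth_onD(2,3)[OF assms(2)]
  note diff = smooth[THEN smooth_onD(1)]
  have "smooth_on U ?g"
    by (rule smooth_on_inner[OF assms(1,2) smooth_on_const])
  hence "\<partial>\<^sub>\<beta> (\<partial>\<^sub>\<alpha> ?g) z = \<partial>\<^sub>\<alpha> (\<partial>\<^sub>\<beta> ?g) z"
    by (intro pd_commute_real[OF assms(1) _ assms(3)]) (simp add: smooth_on_def)
  moreover have "\<partial>\<^sub>\<beta> (\<partial>\<^sub>\<alpha> ?g) z = \<partial>\<^sub>\<beta> (\<lambda>z. \<partial>\<^sub>\<alpha> f z \<bullet> i) z"
    by (rule pd_cong_open(2)[OF assms(1,3)]) (simp add: lin diff)
  moreover have "\<partial>\<^sub>\<alpha> (\<partial>\<^sub>\<beta> ?g) z = \<partial>\<^sub>\<alpha> (\<lambda>z. \<partial>\<^sub>\<beta> f z \<bullet> i) z"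
    by (rule pd_cong_open(1)[OF assms(1,3)]) (simp add: lin diff)
  ultimately show "\<partial>\<^sub>\<beta> (\<partial>\<^sub>\<alpha> f) z \<bullet> i = \<partial>\<^sub>\<alpha> (\<partial>\<^sub>\<beta> f) z \<bullet> i"
    using assms(3) by (simp add: lin diff)
qed

subsection \<open>The Gauss-Mainardi-Codazzi equations\<close>

text \<open>Nonzero pairwise orthogonal vectors are independent, and three independent vectors span
  the space. Distinctness makes \<open>?B\<close> a set of three elements, so the sum over it has
  three terms.\<close>

lemma orthonormal_frame_expand:
  fixes x u v w :: "real^3"
  assumes "u \<bullet> u = 1" "v \<bullet> v = 1" "w \<bullet> w = 1" "u \<bullet> v = 0" "u \<bullet> w = 0" "v \<bullet> w = 0"
  shows "x = (x \<bullet> u) *\<^sub>R u + (x \<bullet> v) *\<^sub>R v + (x \<bullet> w) *\<^sub>R w"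
proof -
  let ?B = "{u, v, w}"
  have orth: "pairwise orthogonal ?B"
    using assms by (auto simp: pairwise_def orthogonal_def inner_commute)
  have ne: "u \<noteq> v" "u \<noteq> w" "v \<noteq> w" and nz: "0 \<notin> ?B"
    using assms by auto
  have "UNIV \<subseteq> span ?B"
    using pairwise_orthogonal_independent[OF orth nz] ne
    by (intro card_ge_dim_independent) auto
  hence "(\<Sum>i\<in>?B. (x \<bullet> i) *\<^sub>R i) = x"
    using assms orth by (intro orthonormal_basis_expand) (auto simp: norm_eq_1)
  thus ?thesis using ne by (simp add: add.assoc)
qed

text \<open>The data prescribe only the derivatives of \<open>N\<close>, so the Gauss-Weingarten
  equations for the tangents come first. Symmetry for \<open>N\<close> then gives the two Codazzi
  equations, and symmetry for the first unit tangent gives the Gauss equation.\<close>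

lemma gauss_mainardi_codazzi:
  assumes S: "surface_data U r N A1 A2 p q H K" and z: "z \<in> U"
  shows "\<partial>\<^sub>\<beta> p z + \<partial>\<^sub>\<alpha> q z + H z * K z = 0" (is ?Gauss)
    and "\<partial>\<^sub>\<beta> H z = p z * K z" (is ?Codazzi1)
    and "\<partial>\<^sub>\<alpha> K z = q z * H z" (is ?Codazzi2)
proof -
  have U: "open U" and r: "smooth_on U r" and N: "smooth_on U N"
    and A1: "smooth_on U A1" and A2: "smooth_on U A2" and p: "smooth_on U p"
    and q: "smooth_on U q" and H: "smooth_on U H" and K: "smooth_on U K"
    using S unfolding surface_data_def curvature_line_coordinates_def by blast+
  have pos: "A1 z > 0" "A2 z > 0" if "z \<in> U" for z
    using S that unfolding surface_data_def by blast+
  have A1_b: "\<partial>\<^sub>\<beta> A1 z = p z * A2 z" and A2_a: "\<partial>\<^sub>\<alpha> A2 z = q z * A1 z" if "z \<in> U" for z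
    using S that unfolding surface_data_def by blast+
  define u v where "u = (\<lambda>z. inverse (A1 z) *\<^sub>R \<partial>\<^sub>\<alpha> r z)" and "v = (\<lambda>z. inverse (A2 z) *\<^sub>R \<partial>\<^sub>\<beta> r z)"
  have u: "smooth_on U u" and v: "smooth_on U v"
    unfolding u_def v_def using pos
    by (intro smooth_on_scaleR[OF U] smooth_on_inverse[OF U] A1 A2 smooth_onD(2,3)[OF r]; force)+
  note diff = smooth_onD(1)[OF r] smooth_onD(1)[OF N] smooth_onD(1)[OF A1] smooth_onD(1)[OF A2]
    smooth_onD(1)[OF p] smooth_onD(1)[OF q] smooth_onD(1)[OF H] smooth_onD(1)[OF K]
    smooth_onD(1)[OF u] smooth_onD(1)[OF v]
  have r_a: "\<partial>\<^sub>\<alpha> r z = A1 z *\<^sub>R u z" and r_b: "\<partial>\<^sub>\<beta> r z = A2 z *\<^sub>R v z" if "z \<in> U" for z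
    using pos[OF that] by (simp_all add: u_def v_def)
  have N_a: "\<partial>\<^sub>\<alpha> N z = H z *\<^sub>R u z" and N_b: "\<partial>\<^sub>\<beta> N z = K z *\<^sub>R v z" if "z \<in> U" for z
    using S that unfolding surface_data_def u_def v_def by blast+
  have on: "u z \<bullet> u z = 1" "v z \<bullet> v z = 1" "N z \<bullet> N z = 1" "u z \<bullet> v z = 0" "u z \<bullet> N z = 0"
      "v z \<bullet> N z = 0" if "z \<in> U" for z
  proof -
    have "\<partial>\<^sub>\<alpha> r z \<bullet> \<partial>\<^sub>\<alpha> r z = (A1 z)\<^sup>2" "\<partial>\<^sub>\<beta> r z \<bullet> \<partial>\<^sub>\<beta> r z = (A2 z)\<^sup>2" "norm (N z) = 1"
      "N z \<bullet> \<partial>\<^sub>\<alpha> r z = 0" "N z \<bullet> \<partial>\<^sub>\<beta> r z = 0" "\<partial>\<^sub>\<alpha> r z \<bullet> \<partial>\<^sub>\<beta> r z = 0"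
      using S that unfolding surface_data_def curvature_line_coordinates_def by blast+
    thus "u z \<bullet> u z = 1" "v z \<bullet> v z = 1" "N z \<bullet> N z = 1" "u z \<bullet> v z = 0" "u z \<bullet> N z = 0"
      "v z \<bullet> N z = 0"
      using pos[OF that] by (simp_all add: u_def v_def power2_eq_square norm_eq_1 inner_commute divide_simps)
  qed
  \<comment> \<open>Each of the six orthonormality facts carries its own premise of membership in
    \<open>U\<close>, hence the six copies of \<open>z\<close> at each use.\<close>
  note expand = orthonormal_frame_expand[OF on]
  have sym: "v z \<bullet> u z = 0" "N z \<bullet> u z = 0" "N z \<bullet> v z = 0" if "z \<in> U" for z
    using on[OF that] by (simp_all add: inner_commute)

  \<comment> \<open>One vector is computed twice, from \<open>A1\<close> times \<open>u\<close> and
    from \<open>A2\<close> times \<open>v\<close>; \<open>p\<close> and \<open>q\<close> enter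
    through the derivatives of \<open>A1\<close> and \<open>A2\<close>.\<close>
  have mixed: "\<partial>\<^sub>\<beta> (\<partial>\<^sub>\<alpha> r) z = (p z * A2 z) *\<^sub>R u z + A1 z *\<^sub>R \<partial>\<^sub>\<beta> u z"
    "\<partial>\<^sub>\<beta> (\<partial>\<^sub>\<alpha> r) z = (q z * A1 z) *\<^sub>R v z + A2 z *\<^sub>R \<partial>\<^sub>\<alpha> v z" if z: "z \<in> U" for z
  proof -
    have "\<partial>\<^sub>\<beta> (\<partial>\<^sub>\<alpha> r) z = \<partial>\<^sub>\<beta> (\<lambda>z. A1 z *\<^sub>R u z) z"
      using r_a by (rule pd_cong_open(2)[OF U z])
    thus "\<partial>\<^sub>\<beta> (\<partial>\<^sub>\<alpha> r) z = (p z * A2 z) *\<^sub>R u z + A1 z *\<^sub>R \<partial>\<^sub>\<beta> u z"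
      using z by (simp add: pd_scaleR diff A1_b)
    have "\<partial>\<^sub>\<beta> (\<partial>\<^sub>\<alpha> r) z = \<partial>\<^sub>\<alpha> (\<partial>\<^sub>\<beta> r) z"
      by (rule pd_commute[OF U r z])
    also have "\<dots> = \<partial>\<^sub>\<alpha> (\<lambda>z. A2 z *\<^sub>R v z) z"
      using r_b by (rule pd_cong_open(1)[OF U z])
    finally show "\<partial>\<^sub>\<beta> (\<partial>\<^sub>\<alpha> r) z = (q z * A1 z) *\<^sub>R v z + A2 z *\<^sub>R \<partial>\<^sub>\<alpha> v z"
      using z by (simp add: pd_scaleR diff A2_a)
  qed

  have inner_pd: "f z \<bullet> \<partial>\<^sub>\<alpha> g z + \<partial>\<^sub>\<alpha> f z \<bullet> g z = 0" "f z \<bullet> \<partial>\<^sub>\<beta> g z + \<partial>\<^sub>\<beta> f z \<bullet> g z = 0"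
    if "smooth_on U f" "smooth_on U g" "\<And>w. w \<in> U \<Longrightarrow> f w \<bullet> g w = c" "z \<in> U"
    for f g :: "real \<times> real \<Rightarrow> real^3" and c z
    using pd_cong_open[OF U that(4), of "\<lambda>z. f z \<bullet> g z" "\<lambda>_. c", OF that(3)] that(1,2,4)
    by (simp_all add: pd_inner pd_const smooth_onD)

  have u_b: "\<partial>\<^sub>\<beta> u z = q z *\<^sub>R v z" and v_a: "\<partial>\<^sub>\<alpha> v z = p z *\<^sub>R u z" if z: "z \<in> U" for z
  proof -
    have uu: "\<partial>\<^sub>\<beta> u z \<bullet> u z = 0" and vv: "\<partial>\<^sub>\<alpha> v z \<bullet> v z = 0"
      using inner_pd(2)[OF u u on(1) z] inner_pd(1)[OF v v on(2) z] by (simp_all add: inner_commute)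
    \<comment> \<open>Diagonality of the second fundamental form removes the normal components of
      \<open>\<partial>\<^sub>\<beta> u\<close> and \<open>\<partial>\<^sub>\<alpha> v\<close>.
      Comparing the tangential components in \<open>eq\<close> then yields \<open>q\<close> and
      \<open>p\<close>.\<close>
    have W: "\<partial>\<^sub>\<beta> (\<partial>\<^sub>\<alpha> r) z \<bullet> N z = 0"
      using S z unfolding surface_data_def curvature_line_coordinates_def by blast
    have uN: "\<partial>\<^sub>\<beta> u z \<bullet> N z = 0" and vN: "\<partial>\<^sub>\<alpha> v z \<bullet> N z = 0"
      using W[unfolded mixed(1)[OF z]] W[unfolded mixed(2)[OF z]] on[OF z] pos[OF z]
      by (simp_all add: inner_add_left)
    have eq: "(p z * A2 z) *\<^sub>R u z + A1 z *\<^sub>R \<partial>\<^sub>\<beta> u z = (q z * A1 z) *\<^sub>R v z + A2 z *\<^sub>R \<partial>\<^sub>\<alpha> v z"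
      using mixed[OF z] by simp
    have "A1 z * (\<partial>\<^sub>\<beta> u z \<bullet> v z) = q z * A1 z"
      using arg_cong[OF eq, of "\<lambda>x. x \<bullet> v z"] on[OF z] vv by (simp add: inner_add_left)
    hence uv: "\<partial>\<^sub>\<beta> u z \<bullet> v z = q z" using pos[OF z] by simp
    have "A2 z * (\<partial>\<^sub>\<alpha> v z \<bullet> u z) = p z * A2 z"
      using arg_cong[OF eq, of "\<lambda>x. x \<bullet> u z"] on[OF z] sym[OF z] uu by (auto simp: inner_add_left)
    hence vu: "\<partial>\<^sub>\<alpha> v z \<bullet> u z = p z" using pos[OF z] by simp
    show "\<partial>\<^sub>\<beta> u z = q z *\<^sub>R v z" "\<partial>\<^sub>\<alpha> v z = p z *\<^sub>R u z"
      using expand[OF z z z z z z, of "\<partial>\<^sub>\<beta> u z"] expand[OF z z z z z z, of "\<partial>\<^sub>\<alpha> v z"]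
      by (simp_all add: uu uv uN vv vu vN)
  qed
  \<comment> \<open>These components follow from differentiating the constant inner products of the
    frame: for example \<open>u \<bullet> v = 0\<close> and
    \<open>\<partial>\<^sub>\<alpha> v = p u\<close> give the coefficient
    \<open>- p\<close>.\<close>
  have u_a: "\<partial>\<^sub>\<alpha> u z = - (p z *\<^sub>R v z) - H z *\<^sub>R N z"
    and v_b: "\<partial>\<^sub>\<beta> v z = - (q z *\<^sub>R u z) - K z *\<^sub>R N z" if z: "z \<in> U" for z
  proof -
    have "\<partial>\<^sub>\<alpha> u z \<bullet> u z = 0" "\<partial>\<^sub>\<alpha> u z \<bullet> v z = - p z" "\<partial>\<^sub>\<alpha> u z \<bullet> N z = - H z"
      using inner_pd(1)[OF u u on(1) z] inner_pd(1)[OF u v on(4) z] inner_pd(1)[OF u N on(5) z]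
        u_b[OF z] v_a[OF z] N_a[OF z] on[OF z] sym[OF z] by (simp_all add: inner_commute)
    thus "\<partial>\<^sub>\<alpha> u z = - (p z *\<^sub>R v z) - H z *\<^sub>R N z"
      using expand[OF z z z z z z, of "\<partial>\<^sub>\<alpha> u z"] by simp
    have "\<partial>\<^sub>\<beta> v z \<bullet> v z = 0" "\<partial>\<^sub>\<beta> v z \<bullet> u z = - q z" "\<partial>\<^sub>\<beta> v z \<bullet> N z = - K z"
      using inner_pd(2)[OF v v on(2) z] inner_pd(2)[OF u v on(4) z] inner_pd(2)[OF v N on(6) z]
        u_b[OF z] v_a[OF z] N_b[OF z] on[OF z] sym[OF z] by (simp_all add: inner_commute)
    thus "\<partial>\<^sub>\<beta> v z = - (q z *\<^sub>R u z) - K z *\<^sub>R N z"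
      using expand[OF z z z z z z, of "\<partial>\<^sub>\<beta> v z"] by simp
  qed

  have "\<partial>\<^sub>\<beta> (\<partial>\<^sub>\<alpha> N) z = \<partial>\<^sub>\<beta> (\<lambda>z. H z *\<^sub>R u z) z"
    using N_a by (rule pd_cong_open(2)[OF U z])
  moreover have "\<partial>\<^sub>\<alpha> (\<partial>\<^sub>\<beta> N) z = \<partial>\<^sub>\<alpha> (\<lambda>z. K z *\<^sub>R v z) z"
    using N_b by (rule pd_cong_open(1)[OF U z])
  ultimately have N_ab: "H z *\<^sub>R q z *\<^sub>R v z + \<partial>\<^sub>\<beta> H z *\<^sub>R u z = K z *\<^sub>R p z *\<^sub>R u z + \<partial>\<^sub>\<alpha> K z *\<^sub>R v z"
    using pd_commute[OF U N z] z by (simp add: pd_scaleR diff u_b v_a)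
  show ?Codazzi1
    using arg_cong[OF N_ab, of "\<lambda>x. x \<bullet> u z"] on[OF z] sym[OF z] by (simp add: inner_add_left)
  show ?Codazzi2
    using arg_cong[OF N_ab, of "\<lambda>x. x \<bullet> v z"] on[OF z] sym[OF z] by (simp add: inner_add_left mult.commute)

  have "\<partial>\<^sub>\<alpha> (\<partial>\<^sub>\<beta> u) z = \<partial>\<^sub>\<alpha> (\<lambda>z. q z *\<^sub>R v z) z"
    using u_b by (rule pd_cong_open(1)[OF U z])
  hence u_ba: "\<partial>\<^sub>\<alpha> (\<partial>\<^sub>\<beta> u) z \<bullet> v z = \<partial>\<^sub>\<alpha> q z"
    using z on[OF z] by (simp add: pd_scaleR diff v_a inner_add_left)
  \<comment> \<open>Only the \<open>v\<close>-component of the mixed derivative of \<open>u\<close>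
    is needed. Differentiating the scalar
    \<open>\<partial>\<^sub>\<alpha> u \<bullet> v = - p\<close> produces it without differentiating
    the full expansion of \<open>\<partial>\<^sub>\<alpha> u\<close>.\<close>
  have "\<partial>\<^sub>\<beta> (\<lambda>z. \<partial>\<^sub>\<alpha> u z \<bullet> v z) z = \<partial>\<^sub>\<beta> (\<lambda>z. - p z) z"
    by (rule pd_cong_open(2)[OF U z]) (simp add: u_a inner_diff_left on sym)
  hence "\<partial>\<^sub>\<alpha> u z \<bullet> \<partial>\<^sub>\<beta> v z + \<partial>\<^sub>\<beta> (\<partial>\<^sub>\<alpha> u) z \<bullet> v z = - \<partial>\<^sub>\<beta> p z"
    using z by (simp add: pd_inner pd_minus diff smooth_onD(1)[OF smooth_onD(2)[OF u]])
  moreover have "\<partial>\<^sub>\<alpha> u z \<bullet> \<partial>\<^sub>\<beta> v z = H z * K z"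
    using z on[OF z] sym[OF z] by (simp add: u_a v_b inner_diff_left inner_diff_right)
  ultimately show ?Gauss
    using u_ba pd_commute[OF U u z] by simp
qed

subsection \<open>Linearised compatibility\<close>

text \<open>Coordinate projections are bounded linear. The coordinates range over any Euclidean
  space, so the lemma applies both to a matrix as a vector of rows and to each row.\<close>

lemma pd_vec_nth:
  fixes f :: "real \<times> real \<Rightarrow> 'a::euclidean_space ^ 'n"
  assumes "\<And>i. (\<lambda>w. f w $ i) differentiable (at z)"
  shows "f differentiable (at z)"
    and "\<partial>\<^sub>\<alpha> f z $ i = \<partial>\<^sub>\<alpha> (\<lambda>w. f w $ i) z" and "\<partial>\<^sub>\<beta> f z $ i = \<partial>\<^sub>\<beta> (\<lambda>w. f w $ i) z"
proof -
  show d: "f differentiable (at z)"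
  proof (subst differentiable_componentwise_within, intro ballI)
    fix b :: "'a ^ 'n" assume "b \<in> Basis"
    then obtain i u where "b = axis i u" "u \<in> Basis"
      by (auto simp: Basis_vec_def)
    thus "(\<lambda>x. f x \<bullet> b) differentiable (at z)"
      using pd_bounded_bilinear(3)[OF bounded_bilinear_inner assms differentiable_const]
      by (simp add: inner_axis)
  qed
  show "\<partial>\<^sub>\<alpha> f z $ i = \<partial>\<^sub>\<alpha> (\<lambda>w. f w $ i) z" "\<partial>\<^sub>\<beta> f z $ i = \<partial>\<^sub>\<beta> (\<lambda>w. f w $ i) z"
    by (simp_all add: pd_bounded_linear[OF bounded_linear_vec_nth d])
qed

lemma pd_matrix_3:
  fixes a b c d e f g h k :: "real \<times> real \<Rightarrow> real"
  defines "F \<equiv> \<lambda>w. vector [vector [a w, b w, c w], vector [d w, e w, f w],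
                             vector [g w, h w, k w]] :: real^3^3"
  assumes "a differentiable (at z)" "b differentiable (at z)" "c differentiable (at z)"
    "d differentiable (at z)" "e differentiable (at z)" "f differentiable (at z)"
    "g differentiable (at z)" "h differentiable (at z)" "k differentiable (at z)"
  shows "\<partial>\<^sub>\<alpha> F z = vector [vector [\<partial>\<^sub>\<alpha> a z, \<partial>\<^sub>\<alpha> b z, \<partial>\<^sub>\<alpha> c z],
      vector [\<partial>\<^sub>\<alpha> d z, \<partial>\<^sub>\<alpha> e z, \<partial>\<^sub>\<alpha> f z], vector [\<partial>\<^sub>\<alpha> g z, \<partial>\<^sub>\<alpha> h z, \<partial>\<^sub>\<alpha> k z]]"
    and "\<partial>\<^sub>\<beta> F z = vector [vector [\<partial>\<^sub>\<beta> a z, \<partial>\<^sub>\<beta> b z, \<partial>\<^sub>\<beta> c z],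
      vector [\<partial>\<^sub>\<beta> d z, \<partial>\<^sub>\<beta> e z, \<partial>\<^sub>\<beta> f z], vector [\<partial>\<^sub>\<beta> g z, \<partial>\<^sub>\<beta> h z, \<partial>\<^sub>\<beta> k z]]"
proof -
  have entry: "(\<lambda>w. F w $ i $ j) differentiable (at z)" for i j
    using exhaust_3[of i] exhaust_3[of j] assms(2-) by (auto simp: F_def)
  note row = pd_vec_nth[OF entry]
  note mat = pd_vec_nth[of F, OF row(1)]
  show "\<partial>\<^sub>\<alpha> F z = vector [vector [\<partial>\<^sub>\<alpha> a z, \<partial>\<^sub>\<alpha> b z, \<partial>\<^sub>\<alpha> c z],
      vector [\<partial>\<^sub>\<alpha> d z, \<partial>\<^sub>\<alpha> e z, \<partial>\<^sub>\<alpha> f z], vector [\<partial>\<^sub>\<alpha> g z, \<partial>\<^sub>\<alpha> h z, \<partial>\<^sub>\<alpha> k z]]"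
    \<comment> \<open>\<open>F\<close> stays folded until the derivatives have been moved to its
      entries; only then are the entries evaluated.\<close>
    by (simp add: vec_eq_iff forall_3 mat row) (simp add: F_def)
  show "\<partial>\<^sub>\<beta> F z = vector [vector [\<partial>\<^sub>\<beta> a z, \<partial>\<^sub>\<beta> b z, \<partial>\<^sub>\<beta> c z],
      vector [\<partial>\<^sub>\<beta> d z, \<partial>\<^sub>\<beta> e z, \<partial>\<^sub>\<beta> f z], vector [\<partial>\<^sub>\<beta> g z, \<partial>\<^sub>\<beta> h z, \<partial>\<^sub>\<beta> k z]]"
    by (simp add: vec_eq_iff forall_3 mat row) (simp add: F_def)
qed

theorem theorem6p3:
  fixes U :: "(real \<times> real) set"
    and r N :: "real \<times> real \<Rightarrow> real^3"
    and A1 A2 p q H K :: "real \<times> real \<Rightarrow> real"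
    and \<epsilon>1 \<epsilon>2 \<omega> k1 k2 \<tau> :: "real \<times> real \<Rightarrow> real"
    and P Q H' K' :: "real \<times> real \<Rightarrow> real"
    and L M L' M' :: "real \<times> real \<Rightarrow> real^3^3"
  assumes surface: "surface_data U r N A1 A2 p q H K"
    and L_def: "L = (\<lambda>z. vector [vector [0, p z, H z],
                                 vector [- p z, 0, 0],
                                 vector [- H z, 0, 0]])"
    and M_def: "M = (\<lambda>z. vector [vector [0, - q z, 0],
                                 vector [q z, 0, K z],
                                 vector [0, - K z, 0]])"
    and strains: "smooth_on U \<epsilon>1" "smooth_on U \<epsilon>2" "smooth_on U \<omega>"
                 "smooth_on U k1" "smooth_on U k2" "smooth_on U \<tau>"
    and P_def: "P = (\<lambda>z. 1 / A2 z * (\<partial>\<^sub>\<beta> (\<lambda>z. A1 z * \<epsilon>1 z) z - \<partial>\<^sub>\<alpha> (\<lambda>z. A2 z * \<omega> z) z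
                                      - \<epsilon>2 z * \<partial>\<^sub>\<beta> A1 z))"
    and Q_def: "Q = (\<lambda>z. 1 / A1 z * (\<partial>\<^sub>\<alpha> (\<lambda>z. A2 z * \<epsilon>2 z) z - \<partial>\<^sub>\<beta> (\<lambda>z. A1 z * \<omega> z) z
                                      - \<epsilon>1 z * \<partial>\<^sub>\<alpha> A2 z))"
    and H'_def: "H' = (\<lambda>z. - k1 z * A1 z)"
    and K'_def: "K' = (\<lambda>z. - k2 z * A2 z)"
    and L'_def: "L' = (\<lambda>z. vector
          [vector [p z * \<omega> z, P z + \<partial>\<^sub>\<alpha> \<omega> z, H' z],
           vector [- P z, - p z * \<omega> z, \<tau> z * A1 z - H z * \<omega> z],
           vector [- H' z, - \<tau> z * A1 z, 0]])"
    and M'_def: "M' = (\<lambda>z. vector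
          [vector [- q z * \<omega> z, - Q z, \<tau> z * A2 z - K z * \<omega> z],
           vector [Q z + \<partial>\<^sub>\<beta> \<omega> z, q z * \<omega> z, K' z],
           vector [- \<tau> z * A2 z, - K' z, 0]])"
  shows "(\<forall>z\<in>U. \<partial>\<^sub>\<beta> L' z - \<partial>\<^sub>\<alpha> M' z = commutator (L' z) (M z) + commutator (L z) (M' z))
     \<longleftrightarrow>
     (\<forall>z\<in>U.
        \<partial>\<^sub>\<beta> P z + \<partial>\<^sub>\<alpha> Q z + \<partial>\<^sub>\<beta> (\<partial>\<^sub>\<alpha> \<omega>) z + H' z * K z + H z * K' z = 0 \<and>
        \<partial>\<^sub>\<beta> H' z - (P z * K z + p z * K' z)
          = \<partial>\<^sub>\<alpha> (\<lambda>z. \<tau> z * A2 z) z + \<tau> z * \<partial>\<^sub>\<alpha> A2 z - \<omega> z * \<partial>\<^sub>\<alpha> K z \<and>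
        \<partial>\<^sub>\<alpha> K' z - (Q z * H z + q z * H' z)
          = \<partial>\<^sub>\<beta> (\<lambda>z. \<tau> z * A1 z) z + \<tau> z * \<partial>\<^sub>\<beta> A1 z - \<omega> z * \<partial>\<^sub>\<beta> H z)"
proof (rule ball_cong[OF refl])
  fix z assume z: "z \<in> U"
  have U: "open U" and smooth: "smooth_on U A1" "smooth_on U A2" "smooth_on U p" "smooth_on U q"
      "smooth_on U H" "smooth_on U K"
    and pos: "\<And>w. w \<in> U \<Longrightarrow> A1 w > 0" "\<And>w. w \<in> U \<Longrightarrow> A2 w > 0"
    and A_pd: "\<partial>\<^sub>\<beta> A1 z = p z * A2 z" "\<partial>\<^sub>\<alpha> A2 z = q z * A1 z"
    using surface z unfolding surface_data_def curvature_line_coordinates_def by blast+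
  have inv: "smooth_on U (\<lambda>z. inverse (A1 z))" "smooth_on U (\<lambda>z. inverse (A2 z))"
    using pos smooth by (auto intro!: smooth_on_inverse[OF U] simp: less_imp_neq[symmetric])
  note smooth_intros = smooth strains inv smooth_onD(2,3) smooth_on_mult[OF U] smooth_on_diff[OF U]
    smooth_on_add[OF U] smooth_on_minus[OF U] smooth_on_const
  \<comment> \<open>Turning \<open>1 / A\<close> into \<open>inverse A\<close> makes
    \<open>P\<close> and \<open>Q\<close> products and differences to which the closure rules
    apply.\<close>
  have smooth': "smooth_on U P" "smooth_on U Q" "smooth_on U H'" "smooth_on U K'"
    unfolding P_def Q_def H'_def K'_def divide_inverse mult_1_left
    by (intro smooth_intros)+
  note diff = smooth_onD(1)[OF _ z]
  \<comment> \<open>The entries are listed exactly as they occur in \<open>L'\<close> and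
    \<open>M'\<close>, to match the premises of \<open>pd_matrix_3\<close>.\<close>
  have entries: "(\<lambda>z. p z * \<omega> z) differentiable (at z)" "(\<lambda>z. P z + \<partial>\<^sub>\<alpha> \<omega> z) differentiable (at z)"
      "(\<lambda>z. - P z) differentiable (at z)" "(\<lambda>z. - p z * \<omega> z) differentiable (at z)"
      "(\<lambda>z. \<tau> z * A1 z - H z * \<omega> z) differentiable (at z)" "(\<lambda>z. - H' z) differentiable (at z)"
      "(\<lambda>z. - \<tau> z * A1 z) differentiable (at z)" "(\<lambda>z. - q z * \<omega> z) differentiable (at z)"
      "(\<lambda>z. - Q z) differentiable (at z)" "(\<lambda>z. \<tau> z * A2 z - K z * \<omega> z) differentiable (at z)"
      "(\<lambda>z. Q z + \<partial>\<^sub>\<beta> \<omega> z) differentiable (at z)" "(\<lambda>z. q z * \<omega> z) differentiable (at z)"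
      "(\<lambda>z. - \<tau> z * A2 z) differentiable (at z)" "(\<lambda>z. - K' z) differentiable (at z)"
      "H' differentiable (at z)" "K' differentiable (at z)"
    by (intro diff smooth' smooth_intros)+
  have L'_b: "\<partial>\<^sub>\<beta> L' z = vector
      [vector [\<partial>\<^sub>\<beta> (\<lambda>z. p z * \<omega> z) z, \<partial>\<^sub>\<beta> (\<lambda>z. P z + \<partial>\<^sub>\<alpha> \<omega> z) z, \<partial>\<^sub>\<beta> H' z],
       vector [\<partial>\<^sub>\<beta> (\<lambda>z. - P z) z, \<partial>\<^sub>\<beta> (\<lambda>z. - p z * \<omega> z) z, \<partial>\<^sub>\<beta> (\<lambda>z. \<tau> z * A1 z - H z * \<omega> z) z],
       vector [\<partial>\<^sub>\<beta> (\<lambda>z. - H' z) z, \<partial>\<^sub>\<beta> (\<lambda>z. - \<tau> z * A1 z) z, \<partial>\<^sub>\<beta> (\<lambda>z. 0) z]]"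
    unfolding L'_def by (intro pd_matrix_3(2) entries differentiable_const)
  have M'_a: "\<partial>\<^sub>\<alpha> M' z = vector
      [vector [\<partial>\<^sub>\<alpha> (\<lambda>z. - q z * \<omega> z) z, \<partial>\<^sub>\<alpha> (\<lambda>z. - Q z) z, \<partial>\<^sub>\<alpha> (\<lambda>z. \<tau> z * A2 z - K z * \<omega> z) z],
       vector [\<partial>\<^sub>\<alpha> (\<lambda>z. Q z + \<partial>\<^sub>\<beta> \<omega> z) z, \<partial>\<^sub>\<alpha> (\<lambda>z. q z * \<omega> z) z, \<partial>\<^sub>\<alpha> K' z],
       vector [\<partial>\<^sub>\<alpha> (\<lambda>z. - \<tau> z * A2 z) z, \<partial>\<^sub>\<alpha> (\<lambda>z. - K' z) z, \<partial>\<^sub>\<alpha> (\<lambda>z. 0) z]]"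
    unfolding M'_def by (intro pd_matrix_3(1) entries differentiable_const)
  note pd = pd_mult pd_add pd_diff pd_minus pd_const diff smooth_onD(2,3) smooth_on_mult[OF U]
    smooth_on_minus[OF U] smooth strains smooth'
  note gmc = gauss_mainardi_codazzi[OF surface z]
  have commute: "\<partial>\<^sub>\<alpha> (\<partial>\<^sub>\<beta> \<omega>) z = \<partial>\<^sub>\<beta> (\<partial>\<^sub>\<alpha> \<omega>) z"
    using pd_commute[OF U strains(3) z] by simp
  have L'_entries: "L' z = vector [vector [p z * \<omega> z, P z + \<partial>\<^sub>\<alpha> \<omega> z, H' z],
      vector [- P z, - p z * \<omega> z, \<tau> z * A1 z - H z * \<omega> z], vector [- H' z, - \<tau> z * A1 z, 0]]"
    unfolding L'_def ..
  have M'_entries: "M' z = vector [vector [- q z * \<omega> z, - Q z, \<tau> z * A2 z - K z * \<omega> z],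
      vector [Q z + \<partial>\<^sub>\<beta> \<omega> z, q z * \<omega> z, K' z], vector [- \<tau> z * A2 z, - K' z, 0]]"
    unfolding M'_def ..
  \<comment> \<open>Solved for \<open>\<partial>\<^sub>\<beta> p\<close>, the Gauss equation
    rewrites the diagonal entries into identities.\<close>
  have gauss: "\<partial>\<^sub>\<beta> p z = - \<partial>\<^sub>\<alpha> q z - H z * K z"
    using gmc(1) by simp
  show "\<partial>\<^sub>\<beta> L' z - \<partial>\<^sub>\<alpha> M' z = commutator (L' z) (M z) + commutator (L z) (M' z) \<longleftrightarrow>
        \<partial>\<^sub>\<beta> P z + \<partial>\<^sub>\<alpha> Q z + \<partial>\<^sub>\<beta> (\<partial>\<^sub>\<alpha> \<omega>) z + H' z * K z + H z * K' z = 0 \<and>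
        \<partial>\<^sub>\<beta> H' z - (P z * K z + p z * K' z)
          = \<partial>\<^sub>\<alpha> (\<lambda>z. \<tau> z * A2 z) z + \<tau> z * \<partial>\<^sub>\<alpha> A2 z - \<omega> z * \<partial>\<^sub>\<alpha> K z \<and>
        \<partial>\<^sub>\<alpha> K' z - (Q z * H z + q z * H' z)
          = \<partial>\<^sub>\<beta> (\<lambda>z. \<tau> z * A1 z) z + \<tau> z * \<partial>\<^sub>\<beta> A1 z - \<omega> z * \<partial>\<^sub>\<beta> H z"
    unfolding vec_eq_iff forall_3 commutator_def
    \<comment> \<open>The passes form the nine entries, carry out the differentiations, and
      substitute the surface equations. By \<open>A_pd\<close>, the terms
      \<open>q * A1 * \<tau>\<close> and \<open>p * A2 * \<tau>\<close> from the commutators match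
      the terms \<open>\<tau> * \<partial>\<^sub>\<alpha> A2\<close> and
      \<open>\<tau> * \<partial>\<^sub>\<beta> A1\<close> of the system. What remains is linear in
      the monomials.\<close>
    by (simp add: L'_b M'_a matrix_matrix_mult_def sum_3 L'_entries M'_entries L_def M_def,
        simp add: pd,
        simp add: gmc(2,3) A_pd gauss commute algebra_simps,
        (intro iffI conjI; elim conjE; linarith))
qed

end
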